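(* Let $G=(V,E)$ be a connected graph on $V=\{1,\dots,n\}$, let $(\xi(t))_{t\ge0}$ be the Averaging Process (Node Model) with parameters $\alpha,k$ and initial vector $\xi(0)\in\mathbb{R}^n$, and let $(W(t))_{t\ge0}$ be the Diffusion Process (with the same $G,\alpha,k$) applied to the cost vector $c=\xi^\top(0)$ and to the $n$ initial load vectors $e^{(u)}$, $u\in V$. Then for each $T\ge0$ the probability distribution of $\xi(T)$ is the same as the probability distribution of $W(T)$; that is, for every column vector $a\in\mathbb{R}^n$, $$\mathbb{P}(\xi(T)=a)=\mathbb{P}(W(T)=a^\top).$$
   Context: Node Model with parameters $\alpha\in[0,1)$ and integer $k\ge1$ (with $k$ at most the minimum degree): $\xi(0)\in\mathbb{R}^n$ is a given column vector. At each step $t\ge1$ a node $u$ is chosen uniformly at random, and then $k$ of its neighbours $v_1,\dots,v_k$ are chosen uniformly at random without replacement (all choices independent over steps); then $\xi_u(t)=\alpha\,\xi_u(t-1)+\frac{1-\alpha}{k}\sum_{i=1}^k\xi_{v_i}(t-1)$ and $\xi_v(t)=\xi_v(t-1)$ for all $v\ne u$. Diffusion Process: at each step $t\ge1$, independently, a node $u(t)$ is sampled uniformly at random and then a set $S(t)$ of $k$ of its neighbours is chosen uniformly at random. Define the $n\times n$ matrix $B(t)$ by $B_{i,j}(t)=1$ if $i=j\ne u(t)$; $\alpha$ if $i=j=u(t)$; $(1-\alpha)/k$ if $i\in S(t)$ and $j=u(t)$; and $0$ otherwise. Let $R(t)=B(t)B(t-1)\cdots B(1)$ (with $R(0)=I$).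 For a cost row vector $c$ and initial load column vectors $q^{(1)}(0),\dots,q^{(r)}(0)$, the loads at time $t$ are $q^{(j)}(t)=R(t)q^{(j)}(0)$ and the state (row vector of costs) is $W(t)=c\,R(t)\,(q^{(1)}(0),\dots,q^{(r)}(0))\in\mathbb{R}^r$. $e^{(u)}$ is the unit column vector with $1$ at position $u$ and $0$ elsewhere. *)

theory Defs
  imports "HOL-Probability.Probability"
begin

text \<open>
  The vertex set \<open>V = {1,\<dots>,n}\<close> is the finite type \<open>'n\<close>, so that \<open>real ^ 'n\<close> is \<open>\<real>\<^sup>n\<close>.
  Row and column vectors both have type \<open>real ^ 'n\<close>; a row vector acts on a matrix through
  \<open>(v*)\<close>. In particular transposing a vector is the identity.
\<close>

definition connected_graph :: "('n \<times> 'n) set \<Rightarrow> bool" where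
  "connected_graph E \<longleftrightarrow> sym E \<and> irrefl E \<and> (\<forall>u v. (u, v) \<in> E\<^sup>*)"

definition neighbours :: "('n \<times> 'n) set \<Rightarrow> 'n \<Rightarrow> 'n set" where
  "neighbours E u = {v. (u, v) \<in> E}"

definition min_degree :: "('n::finite \<times> 'n) set \<Rightarrow> nat" where
  "min_degree E = Min (range (\<lambda>u. card (neighbours E u)))"

text \<open>
  Both choices below are meaningful only for \<open>k \<le> min_degree E\<close>; otherwise some
  \<open>pmf_of_set\<close> is applied to the empty set.
\<close>

definition node_choice :: "('n::finite \<times> 'n) set \<Rightarrow> nat \<Rightarrow> ('n \<times> 'n list) pmf" where
  "node_choice E k =
     bind_pmf (pmf_of_set UNIV) (\<lambda>u.
       map_pmf (Pair u)
         (pmf_of_set {vs. length vs = k \<and> distinct vs \<and> set vs \<subseteq> neighbours E u}))"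

definition diffusion_choice :: "('n::finite \<times> 'n) set \<Rightarrow> nat \<Rightarrow> ('n \<times> 'n set) pmf" where
  "diffusion_choice E k =
     bind_pmf (pmf_of_set UNIV) (\<lambda>u.
       map_pmf (Pair u) (pmf_of_set {S. S \<subseteq> neighbours E u \<and> card S = k}))"

text \<open>
  The processes live on an arbitrary probability space. At step \<open>t \<ge> 1\<close>, \<open>u t\<close> is the chosen
  node and \<open>vs t\<close> the sequence \<open>v\<^sub>1,\<dots>,v\<^sub>k\<close> of its chosen neighbours, numbered from \<open>0\<close> as a
  list. The values of \<open>u\<close> and \<open>vs\<close> at \<open>0\<close> are irrelevant.
\<close>

locale node_model = prob_space M
  for M :: "'w measure"
  and E :: "('n::finite \<times> 'n) set"
  and \<alpha> :: real
  and k :: nat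
  and \<xi>0 :: "real ^ 'n"
  and u :: "nat \<Rightarrow> 'w \<Rightarrow> 'n"
  and vs :: "nat \<Rightarrow> 'w \<Rightarrow> 'n list"
  and \<xi> :: "nat \<Rightarrow> 'w \<Rightarrow> real ^ 'n" +
  assumes choices_indep:
      "indep_vars (\<lambda>_. count_space UNIV) (\<lambda>t \<omega>. (u t \<omega>, vs t \<omega>)) {1..}"
    and choices_distr:
      "\<And>t. t \<ge> 1 \<Longrightarrow>
         distr M (count_space UNIV) (\<lambda>\<omega>. (u t \<omega>, vs t \<omega>)) = measure_pmf (node_choice E k)"
    and init: "\<And>\<omega>. \<omega> \<in> space M \<Longrightarrow> \<xi> 0 \<omega> = \<xi>0"
    and step:
      "\<And>t \<omega>. t \<ge> 1 \<Longrightarrow> \<omega> \<in> space M \<Longrightarrow>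
         \<xi> t \<omega> = (\<chi> v. if v = u t \<omega>
           then \<alpha> * \<xi> (t - 1) \<omega> $ v
                + (1 - \<alpha>) / real k * (\<Sum>i<k. \<xi> (t - 1) \<omega> $ (vs t \<omega> ! i))
           else \<xi> (t - 1) \<omega> $ v)"

definition diffusion_matrix :: "real \<Rightarrow> nat \<Rightarrow> 'n::finite \<Rightarrow> 'n set \<Rightarrow> real ^ 'n ^ 'n" where
  "diffusion_matrix \<alpha> k u S =
     (\<chi> i j. if i = j \<and> j \<noteq> u then 1
             else if i = j \<and> j = u then \<alpha>
             else if i \<in> S \<and> j = u then (1 - \<alpha>) / real k
             else 0)"

primrec backward_product :: "(nat \<Rightarrow> real ^ 'n ^ 'n) \<Rightarrow> nat \<Rightarrow> real ^ 'n ^ 'n::finite" where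
  "backward_product B 0 = mat 1"
| "backward_product B (Suc t) = B (Suc t) ** backward_product B t"

definition matrix_of_columns :: "('r \<Rightarrow> real ^ 'n) \<Rightarrow> real ^ 'r ^ 'n" where
  "matrix_of_columns q = (\<chi> i j. q j $ i)"

locale diffusion_process = prob_space M
  for M :: "'w measure"
  and E :: "('n::finite \<times> 'n) set"
  and \<alpha> :: real
  and k :: nat
  and c :: "real ^ 'n"
  and q :: "'r::finite \<Rightarrow> real ^ 'n"
  and u :: "nat \<Rightarrow> 'w \<Rightarrow> 'n"
  and S :: "nat \<Rightarrow> 'w \<Rightarrow> 'n set"
  and W :: "nat \<Rightarrow> 'w \<Rightarrow> real ^ 'r" +
  assumes choices_indep:
      "indep_vars (\<lambda>_. count_space UNIV) (\<lambda>t \<omega>. (u t \<omega>, S t \<omega>)) {1..}"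
    and choices_distr:
      "\<And>t. t \<ge> 1 \<Longrightarrow>
         distr M (count_space UNIV) (\<lambda>\<omega>. (u t \<omega>, S t \<omega>)) = measure_pmf (diffusion_choice E k)"
    and state:
      "\<And>t \<omega>. \<omega> \<in> space M \<Longrightarrow>
         W t \<omega> = c v* backward_product (\<lambda>s. diffusion_matrix \<alpha> k (u s \<omega>) (S s \<omega>)) t
                  v* matrix_of_columns q"

end

theory Submission
  imports Defs
begin

text \<open>
  One step of the averaging process is multiplication of the row vector \<open>\<xi>\<close> from the right by
  the very matrix \<open>B(t)\<close> that drives the diffusion: column \<open>u\<close> of \<open>B(t)\<close> lists the weights with
  which the entries of \<open>\<xi>\<close> enter the new value at \<open>u\<close> (\<open>vector_diffusion_matrix\<close>). Hence
  \<open>\<xi>(T) = \<xi>(0) B(1) \<dots> B(T)\<close> almost surely (\<open>AE_state_eq\<close>), whereas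
  \<open>W(T) = \<xi>(0) B(T) \<dots> B(1)\<close>, since the unit load vectors form the identity matrix. The two
  states are therefore one functional \<open>F\<close> of the sequence of choices, evaluated once on the
  reversed and once on the original sequence.

  The choices are independent and identically distributed, so the law of the sequence at times
  \<open>1,\<dots>,T\<close> is a power of a single distribution (\<open>iid_functional_law\<close>) and is unchanged by
  the time reversal \<open>s \<mapsto> T + 1 - s\<close> (\<open>distr_PiM_pmf_reindex\<close>). The single-step
  distributions agree in both processes because forgetting the order of a uniform sequence of
  distinct neighbours leaves a uniform set of neighbours (\<open>map_set_node_choice\<close>). The two
  processes may live on different probability spaces, so only laws are compared and no coupling
  is constructed.
\<close>

section \<open>The choice made in a single step\<close>

text \<open>
  Every \<open>k\<close>-subset has the same number \<open>k!\<close> of orderings, so a uniform list is a uniform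
  ordering of a uniform \<open>k\<close>-subset.
\<close>

lemma map_set_pmf_of_set_distinct_lists:
  assumes "finite A" and "k \<le> card A"
  shows "map_pmf set (pmf_of_set {xs. length xs = k \<and> distinct xs \<and> set xs \<subseteq> A})
    = pmf_of_set {S. S \<subseteq> A \<and> card S = k}"
proof -
  let ?\<S> = "{S. S \<subseteq> A \<and> card S = k}"
  have fin: "finite S" if "S \<in> ?\<S>" for S
    using that assms(1) finite_subset by blast
  have lists: "{xs. length xs = k \<and> distinct xs \<and> set xs \<subseteq> A} = \<Union> (permutations_of_set ` ?\<S>)"
    by (auto simp: permutations_of_set_def distinct_card)
  have subsets: "finite ?\<S>" "?\<S> \<noteq> {}"
    using assms obtain_subset_with_card_n[OF assms(2)] by (auto simp: finite_subset)
  have disj: "disjoint_family_on permutations_of_set ?\<S>"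
    by (auto simp: disjoint_family_on_def permutations_of_set_def)
  have "pmf_of_set (\<Union> (permutations_of_set ` ?\<S>))
      = bind_pmf (pmf_of_set ?\<S>) (\<lambda>S. pmf_of_set (permutations_of_set S))"
  proof (rule pmf_of_set_UN[OF _ subsets(2) _ _ disj])
    show "finite (\<Union> (permutations_of_set ` ?\<S>))"
      using subsets(1) by (intro finite_UN_I) simp_all
    show "permutations_of_set S \<noteq> {}" "card (permutations_of_set S) = fact k" if "S \<in> ?\<S>" for S
      using fin[OF that] that by simp_all
  qed
  then have "map_pmf set (pmf_of_set (\<Union> (permutations_of_set ` ?\<S>)))
      = bind_pmf (pmf_of_set ?\<S>) (\<lambda>S. map_pmf set (pmf_of_set (permutations_of_set S)))"
    by (simp only: map_bind_pmf)
  also have "\<dots> = bind_pmf (pmf_of_set ?\<S>) (\<lambda>S. return_pmf S)"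
  proof (rule bind_pmf_cong[OF refl])
    fix S assume "S \<in> set_pmf (pmf_of_set ?\<S>)"
    then have S: "S \<in> ?\<S>"
      using subsets by simp
    have "map_pmf set (pmf_of_set (permutations_of_set S))
        = map_pmf (\<lambda>_. S) (pmf_of_set (permutations_of_set S))"
      by (rule map_pmf_cong) (use fin[OF S] in \<open>auto dest: permutations_of_setD\<close>)
    then show "map_pmf set (pmf_of_set (permutations_of_set S)) = return_pmf S"
      by simp
  qed
  finally show ?thesis
    by (simp add: lists bind_return_pmf')
qed

lemma min_degree_le: "min_degree E \<le> card (neighbours E u)"
  by (simp add: min_degree_def)

lemma map_set_node_choice:
  assumes "k \<le> min_degree E"
  shows "map_pmf (\<lambda>(u, vs). (u, set vs)) (node_choice E k) = diffusion_choice E k"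
proof -
  have "map_pmf (\<lambda>vs. (u, set vs))
        (pmf_of_set {vs. length vs = k \<and> distinct vs \<and> set vs \<subseteq> neighbours E u})
      = map_pmf (Pair u) (pmf_of_set {S. S \<subseteq> neighbours E u \<and> card S = k})" for u
    using map_set_pmf_of_set_distinct_lists[of "neighbours E u" k]
      order_trans[OF assms min_degree_le[of E u]]
    by (simp add: map_pmf_comp flip: map_set_pmf_of_set_distinct_lists)
  then show ?thesis
    by (simp add: node_choice_def diffusion_choice_def map_bind_pmf map_pmf_comp)
qed

text \<open>
  The bound on \<open>k\<close> makes the set of admissible lists nonempty; only then does the support of
  \<open>pmf_of_set\<close> lie in that set.
\<close>

lemma set_pmf_node_choice:
  assumes "k \<le> min_degree E" and "(u, vs) \<in> set_pmf (node_choice E k)"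
  shows "length vs = k" and "distinct vs" and "set vs \<subseteq> neighbours E u"
proof -
  have "vs \<in> {vs. length vs = k \<and> distinct vs \<and> set vs \<subseteq> neighbours E u}"
    if "vs \<in> set_pmf (pmf_of_set {vs. length vs = k \<and> distinct vs \<and> set vs \<subseteq> neighbours E u})"
  proof -
    let ?L = "{vs. length vs = k \<and> distinct vs \<and> set vs \<subseteq> neighbours E u}"
    obtain S where "S \<subseteq> neighbours E u" "card S = k" "finite S"
      using obtain_subset_with_card_n[OF order_trans[OF assms(1) min_degree_le[of E u]]] by auto
    moreover from \<open>finite S\<close> obtain xs where "set xs = S" "distinct xs"
      using finite_distinct_list by blast
    ultimately have "xs \<in> ?L"
      using distinct_card[of xs] by simp
    then have "?L \<noteq> {}"
      by (rule ex_in_conv[THEN iffD1, OF exI])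
    moreover have "finite ?L"
      by (rule finite_subset[OF _ finite_lists_length_eq[of "neighbours E u" k]]) auto
    ultimately show ?thesis
      using that by simp
  qed
  then show "length vs = k" and "distinct vs" and "set vs \<subseteq> neighbours E u"
    using assms(2) by (auto simp: node_choice_def)
qed

section \<open>The matrix of a step and products of such matrices\<close>

text \<open>
  The duality behind the theorem: acting on costs from the right, the matrix of a diffusion step
  performs an averaging step. If \<open>u \<in> S\<close>, the diagonal entry \<open>\<alpha>\<close> would hide the
  contribution of \<open>u\<close> to the sum over \<open>S\<close>.
\<close>

lemma vector_diffusion_matrix:
  assumes "u \<notin> S"
  shows "x v* diffusion_matrix \<alpha> k u S
    = (\<chi> v. if v = u then \<alpha> * x $ v + (1 - \<alpha>) / real k * (\<Sum>i\<in>S. x $ i) else x $ v)"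
proof (rule vec_eq_iff[THEN iffD2], rule allI)
  fix v
  let ?rhs = "(\<chi> v. if v = u then \<alpha> * x $ v + (1 - \<alpha>) / real k * (\<Sum>i\<in>S. x $ i) else x $ v)"
  show "(x v* diffusion_matrix \<alpha> k u S) $ v = ?rhs $ v"
  proof (cases "v = u")
    case False
    then have "(x v* diffusion_matrix \<alpha> k u S) $ v = (\<Sum>i\<in>UNIV. if i = v then x $ i else 0)"
      unfolding vector_matrix_mult_def diffusion_matrix_def vec_lambda_beta
      by (intro sum.cong) auto
    with False show ?thesis by simp
  next
    case True
    have "(x v* diffusion_matrix \<alpha> k u S) $ u
        = (\<Sum>i\<in>UNIV. (if i = u then \<alpha> * x $ i else 0)
            + (if i \<in> S then (1 - \<alpha>) / real k * x $ i else 0))"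
      unfolding vector_matrix_mult_def diffusion_matrix_def
      using assms by (auto intro!: sum.cong)
    also have "\<dots> = \<alpha> * x $ u + (1 - \<alpha>) / real k * (\<Sum>i\<in>S. x $ i)"
      by (simp add: sum.distrib sum.inter_restrict[symmetric] sum_distrib_left
          flip: sum.inter_filter)
    finally show ?thesis using True by simp
  qed
qed

text \<open>
  The definition peels off the latest factor on the left; time reversal needs the earliest one,
  which is the rightmost.
\<close>

lemma backward_product_Suc_shift:
  "backward_product B (Suc t) = backward_product (\<lambda>s. B (Suc s)) t ** B 1"
proof (induction t)
  case (Suc t)
  have "backward_product B (Suc (Suc t)) = B (Suc (Suc t)) ** backward_product B (Suc t)"
    by simp
  also have "\<dots> = B (Suc (Suc t)) ** (backward_product (\<lambda>s. B (Suc s)) t ** B 1)"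
    by (simp only: Suc.IH)
  finally show ?case
    by (simp add: matrix_mul_assoc)
qed simp

text \<open>
  The product of the reversed sequence, \<open>B(1) \<dots> B(t)\<close>, grows on the right. This is the
  recursion that the averaging process obeys.
\<close>

lemma backward_product_reverse_Suc:
  "backward_product (\<lambda>s. B (Suc (Suc t) - s)) (Suc t)
    = backward_product (\<lambda>s. B (Suc t - s)) t ** B (Suc t)"
  by (subst backward_product_Suc_shift) simp

lemma backward_product_cong:
  assumes "\<And>s. s \<in> {1..t} \<Longrightarrow> B s = B' s"
  shows "backward_product B t = backward_product B' t"
  using assms by (induction t) auto

lemma matrix_of_columns_axis: "matrix_of_columns (\<lambda>v. axis v 1) = mat 1"
  by (auto simp: matrix_of_columns_def mat_def axis_def vec_eq_iff)

section \<open>Functionals of finitely many discrete i.i.d. variables\<close>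

text \<open>
  A finite product of countable discrete spaces is again discrete, so measurability is automatic.
\<close>

lemma borel_measurable_PiM_pmf:
  fixes F :: "('i \<Rightarrow> 'a::countable) \<Rightarrow> 'b::topological_space"
  assumes "finite I"
  shows "F \<in> borel_measurable (\<Pi>\<^sub>M i\<in>I. measure_pmf p)"
proof -
  have "sets (\<Pi>\<^sub>M i\<in>I. measure_pmf p) = sets (\<Pi>\<^sub>M i\<in>I. count_space (UNIV :: 'a set))"
    by (intro sets_PiM_cong) auto
  also have "\<dots> = sets (count_space (PiE I (\<lambda>_. UNIV :: 'a set)))"
    by (subst count_space_PiM_finite[OF assms]) auto
  finally have "borel_measurable (\<Pi>\<^sub>M i\<in>I. measure_pmf p)
      = (borel_measurable (count_space (PiE I (\<lambda>_. UNIV))) :: (('i \<Rightarrow> 'a) \<Rightarrow> 'b) set)"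
    by (rule measurable_cong_sets) (rule refl)
  then show ?thesis
    by simp
qed

text \<open>
  Independence turns the joint law into a product, and the functional only sees the joint law.
  It acts on total functions, so that a recursively defined state can be used as it stands,
  without extending the choices by \<open>undefined\<close> outside \<open>I\<close>.
\<close>

lemma (in prob_space) iid_functional:
  fixes X :: "'i \<Rightarrow> 'a \<Rightarrow> 'b::countable" and F :: "('i \<Rightarrow> 'b) \<Rightarrow> 'c::topological_space"
  assumes indep: "indep_vars (\<lambda>_. count_space UNIV) X I" and fin: "finite I"
    and distr: "\<And>i. i \<in> I \<Longrightarrow> distr M (count_space UNIV) (X i) = measure_pmf p"
    and F: "\<And>f g. (\<And>i. i \<in> I \<Longrightarrow> f i = g i) \<Longrightarrow> F f = F g"
  shows iid_functional_measurable: "(\<lambda>\<omega>. F (\<lambda>i. X i \<omega>)) \<in> borel_measurable M"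
    and iid_functional_law:
      "distr M borel (\<lambda>\<omega>. F (\<lambda>i. X i \<omega>)) = distr (\<Pi>\<^sub>M i\<in>I. measure_pmf p) borel F"
proof -
  let ?P = "\<Pi>\<^sub>M i\<in>I. count_space (UNIV :: 'b set)"
  let ?X = "\<lambda>\<omega>. \<lambda>i\<in>I. X i \<omega>"
  have rv: "X i \<in> measurable M (count_space UNIV)" if "i \<in> I" for i
    using indep that by (auto simp: indep_vars_def)
  have FX: "F (\<lambda>i. X i \<omega>) = F (?X \<omega>)" for \<omega>
    by (rule F) simp
  have "borel_measurable ?P
      = (borel_measurable (\<Pi>\<^sub>M i\<in>I. measure_pmf p) :: (('i \<Rightarrow> 'b) \<Rightarrow> 'c) set)"
    by (intro measurable_cong_sets sets_PiM_cong) auto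
  then have F_meas: "F \<in> borel_measurable ?P"
    using borel_measurable_PiM_pmf[OF fin, of F p] by simp
  have X_meas: "?X \<in> measurable M ?P"
    using rv by (intro measurable_restrict) auto
  show "(\<lambda>\<omega>. F (\<lambda>i. X i \<omega>)) \<in> borel_measurable M"
    unfolding FX using measurable_compose[OF X_meas F_meas] .
  have law: "distr M ?P ?X = (\<Pi>\<^sub>M i\<in>I. measure_pmf p)" if "I \<noteq> {}"
  proof -
    have "distr M ?P ?X = (\<Pi>\<^sub>M i\<in>I. distr M (count_space UNIV) (X i))"
      using indep_vars_iff_distr_eq_PiM'[where I = I and X = X and M' = "\<lambda>_. count_space UNIV"] that rv indep
      by blast
    also have "\<dots> = (\<Pi>\<^sub>M i\<in>I. measure_pmf p)"
      by (intro PiM_cong) (simp_all add: distr)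
    finally show ?thesis .
  qed
  show "distr M borel (\<lambda>\<omega>. F (\<lambda>i. X i \<omega>)) = distr (\<Pi>\<^sub>M i\<in>I. measure_pmf p) borel F"
  proof (cases "I = {}")
    case True
    \<comment> \<open>The characterisation of independence by product measures is for nonempty index sets. Here
      the functional is constant and both laws are the same point mass.\<close>
    interpret P: prob_space "\<Pi>\<^sub>M i\<in>I. measure_pmf p"
      by (intro prob_space_PiM prob_space_measure_pmf)
    have const: "F = (\<lambda>_. F undefined)"
      using F True by (intro ext) blast
    show ?thesis
      by (subst (1 2) const) (simp add: distr_const P.distr_const)
  next
    case False
    have "distr M borel (\<lambda>\<omega>. F (\<lambda>i. X i \<omega>)) = distr (distr M ?P ?X) borel F"
      unfolding FX using distr_distr[OF F_meas X_meas] by (simp add: comp_def)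
    then show ?thesis
      by (simp only: law[OF False])
  qed
qed

text \<open>
  An injection of the finite set \<open>I\<close> into itself permutes the factors of the product, and all
  factors are equal.
\<close>

lemma distr_PiM_pmf_reindex:
  fixes F :: "('i \<Rightarrow> 'a::countable) \<Rightarrow> 'b::topological_space"
  assumes fin: "finite I" and \<sigma>: "inj_on \<sigma> I" "\<sigma> ` I \<subseteq> I"
    and F: "\<And>f g. (\<And>i. i \<in> I \<Longrightarrow> f i = g i) \<Longrightarrow> F f = F g"
  shows "distr (\<Pi>\<^sub>M i\<in>I. measure_pmf p) borel (\<lambda>f. F (\<lambda>i. f (\<sigma> i)))
    = distr (\<Pi>\<^sub>M i\<in>I. measure_pmf p) borel F"
proof -
  let ?P = "\<Pi>\<^sub>M i\<in>I. measure_pmf p"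
  let ?r = "\<lambda>f. \<lambda>i\<in>I. f (\<sigma> i)"
  have r: "?r \<in> measurable ?P ?P"
    using \<sigma>(2) by (intro measurable_restrict measurable_component_singleton) auto
  have "distr ?P ?P ?r = ?P"
    using distr_PiM_reindex[of I "\<lambda>_. measure_pmf p" \<sigma> I] \<sigma>
    by (auto simp: prob_space_measure_pmf)
  moreover have "F (\<lambda>i. f (\<sigma> i)) = F (?r f)" for f
    by (rule F) simp
  ultimately show ?thesis
    using distr_distr[OF borel_measurable_PiM_pmf[OF fin] r, of F] by (simp add: comp_def)
qed

section \<open>The averaging process as a product of matrices\<close>

lemma (in node_model) choice_measurable:
  assumes "t \<ge> 1"
  shows "(\<lambda>\<omega>. (u t \<omega>, vs t \<omega>)) \<in> measurable M (count_space UNIV)"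
  using choices_indep assms by (simp add: indep_vars_def)

text \<open>
  The product formula below holds only almost everywhere, which on a possibly incomplete space
  does not yield measurability. It is proved from the recursion: for each of the countably many
  choices a step is continuous in the previous state.
\<close>

lemma (in node_model) state_measurable: "\<xi> t \<in> borel_measurable M"
proof (induction t)
  case 0
  then show ?case
    using init by (subst measurable_cong[of _ _ "\<lambda>_. \<xi>0"]) auto
next
  case (Suc t)
  define h where "h = (\<lambda>(w, ws) x. \<chi> v. if v = w
      then \<alpha> * x $ v + (1 - \<alpha>) / real k * (\<Sum>i<k. x $ (ws ! i)) else (x :: real ^ 'n) $ v)"
  have "continuous_on UNIV (h p)" for p
  proof (cases p)
    case (Pair w ws)
    have "continuous_on UNIV (\<lambda>x. if v = w
        then \<alpha> * x $ v + c * (\<Sum>i<k. x $ (ws ! i)) else (x :: real ^ 'n) $ v)" for v and c :: real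
      by (cases "v = w") (auto intro!: continuous_intros)
    then show ?thesis
      unfolding h_def Pair by (auto intro: continuous_on_vec_lambda)
  qed
  then have "(\<lambda>\<omega>. h p (\<xi> t \<omega>)) \<in> borel_measurable M" for p
    using Suc.IH by (intro measurable_compose[OF Suc.IH] borel_measurable_continuous_onI)
  then have "(\<lambda>\<omega>. h (u (Suc t) \<omega>, vs (Suc t) \<omega>) (\<xi> t \<omega>)) \<in> borel_measurable M"
    by (rule measurable_compose_countable) (rule choice_measurable, simp)
  then show ?case
    by (subst measurable_cong) (auto simp: step h_def)
qed

lemma (in node_model) AE_choice:
  assumes "k \<le> min_degree E" and "t \<ge> 1"
  shows "AE \<omega> in M. length (vs t \<omega>) = k \<and> distinct (vs t \<omega>) \<and> set (vs t \<omega>) \<subseteq> neighbours E (u t \<omega>)"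
proof -
  have "AE p in measure_pmf (node_choice E k).
      length (snd p) = k \<and> distinct (snd p) \<and> set (snd p) \<subseteq> neighbours E (fst p)"
    using set_pmf_node_choice[OF assms(1)] by (auto simp: AE_measure_pmf_iff)
  then show ?thesis
    unfolding choices_distr[OF assms(2), symmetric]
    by (subst (asm) AE_distr_iff[OF choice_measurable[OF assms(2)]]) auto
qed

text \<open>
  The identity can fail on the null set where the chosen list has repetitions, the wrong length
  or an entry that is not a neighbour: there the sum over the list may differ from the sum over
  its set. Irreflexivity keeps \<open>u\<close> out of its own neighbourhood.
\<close>

lemma (in node_model) AE_state_eq:
  assumes "k \<le> min_degree E" and "irrefl E"
  shows "AE \<omega> in M. \<xi> t \<omega>
    = \<xi>0 v* backward_product (\<lambda>s. diffusion_matrix \<alpha> k (u (Suc t - s) \<omega>) (set (vs (Suc t - s) \<omega>))) t"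
proof (induction t)
  case 0
  show ?case using init by (auto intro: AE_I2)
next
  case (Suc t)
  have "AE \<omega> in M. length (vs (Suc t) \<omega>) = k \<and> distinct (vs (Suc t) \<omega>)
      \<and> set (vs (Suc t) \<omega>) \<subseteq> neighbours E (u (Suc t) \<omega>)"
    by (rule AE_choice[OF assms(1)]) simp
  with Suc.IH AE_space show ?case
  proof eventually_elim
    case (elim \<omega>)
    let ?B = "\<lambda>s. diffusion_matrix \<alpha> k (u s \<omega>) (set (vs s \<omega>))"
    have "u (Suc t) \<omega> \<notin> set (vs (Suc t) \<omega>)"
      using elim assms(2) by (auto simp: neighbours_def irrefl_def)
    moreover have "(\<Sum>i<k. x $ (vs (Suc t) \<omega> ! i)) = (\<Sum>v\<in>set (vs (Suc t) \<omega>). x $ v)"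
      for x :: "real ^ 'n"
      using elim by (intro sum.reindex_bij_betw bij_betw_nth) auto
    ultimately have "\<xi> (Suc t) \<omega> = \<xi> t \<omega> v* ?B (Suc t)"
      using step[of "Suc t" \<omega>] \<open>\<omega> \<in> space M\<close> by (simp add: vector_diffusion_matrix cong: if_cong)
    also have "\<dots> = (\<xi>0 v* backward_product (\<lambda>s. ?B (Suc t - s)) t) v* ?B (Suc t)"
      using elim by simp
    finally show ?case
      unfolding backward_product_reverse_Suc[of ?B] vector_matrix_mul_assoc .
  qed
qed

section \<open>Equality of the laws\<close>

theorem proposition5p1:
  fixes E :: "('n::finite \<times> 'n) set"
    and \<alpha> :: real and k :: nat
    and \<xi>0 :: "real ^ 'n"
    and M :: "'w measure" and u :: "nat \<Rightarrow> 'w \<Rightarrow> 'n" and vs :: "nat \<Rightarrow> 'w \<Rightarrow> 'n list"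
    and \<xi> :: "nat \<Rightarrow> 'w \<Rightarrow> real ^ 'n"
    and N :: "'z measure" and u' :: "nat \<Rightarrow> 'z \<Rightarrow> 'n" and S :: "nat \<Rightarrow> 'z \<Rightarrow> 'n set"
    and W :: "nat \<Rightarrow> 'z \<Rightarrow> real ^ 'n"
    and T :: nat
  assumes "connected_graph E"
    and "0 \<le> \<alpha>" and "\<alpha> < 1"
    and "1 \<le> k" and "k \<le> min_degree E"
    and "node_model M E \<alpha> k \<xi>0 u vs \<xi>"
    and "diffusion_process N E \<alpha> k \<xi>0 (\<lambda>v. axis v 1) u' S W"
  shows "distr M borel (\<xi> T) = distr N borel (W T) \<and>
    (\<forall>a :: real ^ 'n.
       measure M {\<omega> \<in> space M. \<xi> T \<omega> = a} = measure N {\<omega> \<in> space N. W T \<omega> = a})"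
proof -
  interpret M: node_model M E \<alpha> k \<xi>0 u vs \<xi> by fact
  interpret N: diffusion_process N E \<alpha> k \<xi>0 "\<lambda>v. axis v 1" u' S W by fact
  have irrefl: "irrefl E"
    using assms(1) by (simp add: connected_graph_def)
  define I where "I = {1..T}"
  define \<sigma> where "\<sigma> = (\<lambda>s. Suc T - s)"
  \<comment> \<open>The diffusion state as a function of the choices; the averaging state is the same function
    of the choices read backwards.\<close>
  define F where
    "F = (\<lambda>f. \<xi>0 v* backward_product (\<lambda>s. case f s of (u, S) \<Rightarrow> diffusion_matrix \<alpha> k u S) T)"
  define X where "X = (\<lambda>t \<omega>. case (u t \<omega>, vs t \<omega>) of (u, vs) \<Rightarrow> (u, set vs))"
  define Y where "Y = (\<lambda>t \<omega>. (u' t \<omega>, S t \<omega>))"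
  let ?D = "diffusion_choice E k"
  have fin: "finite I" by (simp add: I_def)
  have \<sigma>: "inj_on \<sigma> I" "\<sigma> ` I \<subseteq> I"
    by (auto simp: \<sigma>_def I_def inj_on_def)
  have F_cong: "F f = F g" if "\<And>i. i \<in> I \<Longrightarrow> f i = g i" for f g
    unfolding F_def using that
    by (intro arg_cong[where f = "(v*) \<xi>0"] backward_product_cong) (simp add: I_def)
  have F\<sigma>_cong: "F (\<lambda>i. f (\<sigma> i)) = F (\<lambda>i. g (\<sigma> i))" if "\<And>i. i \<in> I \<Longrightarrow> f i = g i" for f g
    by (rule F_cong) (use that \<sigma>(2) in blast)
  have X_indep: "M.indep_vars (\<lambda>_. count_space UNIV) X I"
    unfolding X_def
    by (rule M.indep_vars_compose2[OF M.indep_vars_subset[OF M.choices_indep]])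
       (auto simp: I_def)
  have X_distr: "distr M (count_space UNIV) (X t) = measure_pmf ?D" if "t \<in> I" for t
  proof -
    have t: "t \<ge> 1" using that by (simp add: I_def)
    have "measure_pmf ?D = distr (measure_pmf (node_choice E k)) (count_space UNIV)
        (\<lambda>(u, vs). (u, set vs))"
      by (simp flip: map_set_node_choice[OF assms(5)] add: map_pmf_rep_eq)
    also have "\<dots> = distr M (count_space UNIV) (X t)"
      unfolding M.choices_distr[OF t, symmetric]
      by (subst distr_distr) (use M.choice_measurable[OF t] in \<open>auto simp: X_def comp_def\<close>)
    finally show ?thesis ..
  qed
  have Y_indep: "N.indep_vars (\<lambda>_. count_space UNIV) Y I"
    unfolding Y_def by (rule N.indep_vars_subset[OF N.choices_indep]) (auto simp: I_def)
  have Y_distr: "distr N (count_space UNIV) (Y t) = measure_pmf ?D" if "t \<in> I" for t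
    unfolding Y_def by (rule N.choices_distr) (use that in \<open>simp add: I_def\<close>)

  have \<xi>_meas: "\<xi> T \<in> borel_measurable M"
    by (rule M.state_measurable)
  have W_eq: "W T \<omega> = F (\<lambda>i. Y i \<omega>)" if "\<omega> \<in> space N" for \<omega>
    by (simp add: N.state[OF that] F_def Y_def matrix_of_columns_axis)
  have W_meas: "W T \<in> borel_measurable N"
    using N.iid_functional_measurable[OF Y_indep fin Y_distr F_cong]
    by (subst measurable_cong[OF W_eq]) auto

  have "distr M borel (\<xi> T) = distr M borel (\<lambda>\<omega>. F (\<lambda>i. X (\<sigma> i) \<omega>))"
  proof (rule distr_cong_AE[OF refl refl _ \<xi>_meas])
    show "AE \<omega> in M. \<xi> T \<omega> = F (\<lambda>i. X (\<sigma> i) \<omega>)"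
      using M.AE_state_eq[OF assms(5) irrefl, of T] by (simp add: F_def X_def \<sigma>_def)
    show "(\<lambda>\<omega>. F (\<lambda>i. X (\<sigma> i) \<omega>)) \<in> borel_measurable M"
      by (rule M.iid_functional_measurable[OF X_indep fin X_distr F\<sigma>_cong])
  qed
  also have "\<dots> = distr (\<Pi>\<^sub>M i\<in>I. measure_pmf ?D) borel (\<lambda>f. F (\<lambda>i. f (\<sigma> i)))"
    by (rule M.iid_functional_law[OF X_indep fin X_distr F\<sigma>_cong])
  also have "\<dots> = distr (\<Pi>\<^sub>M i\<in>I. measure_pmf ?D) borel F"
    by (rule distr_PiM_pmf_reindex[OF fin \<sigma> F_cong])
  also have "\<dots> = distr N borel (\<lambda>\<omega>. F (\<lambda>i. Y i \<omega>))"
    by (rule N.iid_functional_law[OF Y_indep fin Y_distr F_cong, symmetric])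
  also have "\<dots> = distr N borel (W T)"
    by (intro distr_cong) (simp_all add: W_eq)
  finally have laws: "distr M borel (\<xi> T) = distr N borel (W T)" .
  moreover have "measure M {\<omega> \<in> space M. \<xi> T \<omega> = a} = measure N {\<omega> \<in> space N. W T \<omega> = a}" for a
  proof -
    have "measure M {\<omega> \<in> space M. \<xi> T \<omega> = a} = measure (distr M borel (\<xi> T)) {a}"
      by (subst measure_distr[OF \<xi>_meas]) (auto intro!: arg_cong[where f = "measure M"])
    also have "\<dots> = measure N {\<omega> \<in> space N. W T \<omega> = a}"
      unfolding laws
      by (subst measure_distr[OF W_meas]) (auto intro!: arg_cong[where f = "measure N"])
    finally show ?thesis .
  qed
  ultimately show ?thesis by blast
qed

end
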